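(* Let $P$ be the level poset of the matrix $$M=\begin{pmatrix}1&1&1&0\\1&0&1&1\\0&1&0&1\\1&0&1&1\end{pmatrix}$$ with rows and columns indexed by $\{1,2,3,4\}$; this is a level Eulerian poset. For every $m\ge 0$, the $\mathbf{c}\mathbf{d}$-index of the interval $[(1,0),(1,m+1)]$ of $P$ is the sum of all $\mathbf{c}\mathbf{d}$-monomials of degree $m$.
   Context: Level poset: for a $0/1$ square matrix $M$ with rows and columns indexed by a finite nonempty set $V$, the level poset of $M$ is the poset on $V\times\mathbb{Z}$ with $(u,i)<(v,j)$ if and only if $i<j$ and $(M^{j-i})_{u,v}>0$; the second coordinate is its rank function. A finite graded poset (with minimum, maximum and rank function $\rho$) is Eulerian if every interval $[x,y]$ in it of rank at least $1$ satisfies $\sum_{x\le z\le y}(-1)^{\rho(z)}=0$. A level poset is level Eulerian if every one of its intervals is Eulerian. $\mathbf{a}\mathbf{b}$-index: for a finite graded poset $Q$ of rank $m+1$ with minimum $\hat0$, maximum $\hat1$ and rank function $\rho$, and a chain $c=\{\hat0=x_0<x_1<\cdots<x_{k+1}=\hat1\}$, put $$\operatorname{wt}(c)=(\mathbf{a}-\mathbf{b})^{\rho(x_0,x_1)-1}\cdot\mathbf{b}\cdot(\mathbf{a}-\mathbf{b})^{\rho(x_1,x_2)-1}\cdot\mathbf{b}\cdots\mathbf{b}\cdot(\mathbf{a}-\mathbf{b})^{\rho(x_k,x_{k+1})-1},$$ where $\rho(x,y)=\rho(y)-\rho(x)$ and $\mathbf{a},\mathbf{b}$ are non-commuting variables.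 Then $\Psi(Q)=\sum_c\operatorname{wt}(c)$, summed over all chains $c$ containing $\hat0$ and $\hat1$. For Eulerian $Q$, $\Psi(Q)$ can be written (uniquely) as a non-commutative polynomial in $\mathbf{c}=\mathbf{a}+\mathbf{b}$ (degree 1) and $\mathbf{d}=\mathbf{a}\mathbf{b}+\mathbf{b}\mathbf{a}$ (degree 2); this polynomial is the $\mathbf{c}\mathbf{d}$-index of $Q$. A $\mathbf{c}\mathbf{d}$-monomial of degree $m$ is a word in $\mathbf{c},\mathbf{d}$ whose total degree is $m$. *)

theory Defs
  imports "HOL-Analysis.Analysis" "HOL-Library.Poly_Mapping"
begin

section \<open>Finite graded and Eulerian posets\<close>

text \<open>A poset is given by its (reflexive) order relation \<open>r\<close>; its underlying set is
  \<^term>\<open>Field r\<close>.  A rank function is required to increase by one along covers, but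
  is not normalised to vanish at the minimum: only rank differences matter below, and this
  lets an interval of a larger poset inherit the ambient rank function.\<close>

definition interval :: "'a rel \<Rightarrow> 'a \<Rightarrow> 'a \<Rightarrow> 'a set" where
  "interval r x y = {z. (x, z) \<in> r \<and> (z, y) \<in> r}"

definition interval_poset :: "'a rel \<Rightarrow> 'a \<Rightarrow> 'a \<Rightarrow> 'a rel" where
  "interval_poset r x y = Restr r (interval r x y)"

definition least_in :: "'a rel \<Rightarrow> 'a \<Rightarrow> bool" where
  "least_in r x \<longleftrightarrow> x \<in> Field r \<and> (\<forall>z\<in>Field r. (x, z) \<in> r)"

definition greatest_in :: "'a rel \<Rightarrow> 'a \<Rightarrow> bool" where
  "greatest_in r x \<longleftrightarrow> x \<in> Field r \<and> (\<forall>z\<in>Field r. (z, x) \<in> r)"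

definition covers :: "'a rel \<Rightarrow> 'a \<Rightarrow> 'a \<Rightarrow> bool" where
  "covers r y x \<longleftrightarrow> (x, y) \<in> r \<and> x \<noteq> y \<and> interval r x y = {x, y}"

definition finite_graded_poset :: "'a rel \<Rightarrow> ('a \<Rightarrow> int) \<Rightarrow> bool" where
  "finite_graded_poset r \<rho> \<longleftrightarrow>
     finite (Field r) \<and> Partial_order r \<and>
     (\<exists>x. least_in r x) \<and> (\<exists>x. greatest_in r x) \<and>
     (\<forall>x y. covers r y x \<longrightarrow> \<rho> y = \<rho> x + 1)"

text \<open>The alternating sum is taken in the rationals because ranks are integers and
  \<^term>\<open>(powi)\<close> needs inverses.\<close>

definition eulerian :: "'a rel \<Rightarrow> ('a \<Rightarrow> int) \<Rightarrow> bool" where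
  "eulerian r \<rho> \<longleftrightarrow>
     finite_graded_poset r \<rho> \<and>
     (\<forall>x y. (x, y) \<in> r \<and> \<rho> y - \<rho> x \<ge> 1 \<longrightarrow>
        (\<Sum>z\<in>interval r x y. (-1 :: rat) powi \<rho> z) = 0)"

section \<open>Level posets\<close>

primrec matpow :: "nat ^ 'v ^ 'v \<Rightarrow> nat \<Rightarrow> nat ^ 'v ^ 'v" where
  "matpow M 0 = mat 1"
| "matpow M (Suc n) = matpow M n ** M"

text \<open>For a 0/1 matrix \<open>M\<close>; the rank function is \<^term>\<open>snd\<close>.\<close>

definition level_poset :: "nat ^ 'v ^ 'v \<Rightarrow> ('v \<times> int) rel" where
  "level_poset M =
     {((u, i), (v, j)). (u, i) = (v, j) \<or> (i < j \<and> matpow M (nat (j - i)) $ u $ v > 0)}"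

definition level_eulerian :: "nat ^ 'v ^ 'v \<Rightarrow> bool" where
  "level_eulerian M \<longleftrightarrow>
     (\<forall>x y. (x, y) \<in> level_poset M \<longrightarrow> eulerian (interval_poset (level_poset M) x y) snd)"

section \<open>Non-commutative polynomials\<close>

text \<open>Non-commutative polynomials with integer coefficients are finitely supported functions
  on words.  Concatenation of words is written additively, so that the convolution product
  of \<^type>\<open>poly_mapping\<close> is the multiplication of the free associative algebra.\<close>

datatype 'x free_word = Word (letters: "'x list")

instantiation free_word :: (type) monoid_add
begin

definition zero_free_word :: "'a free_word" where
  "0 = Word []"

definition plus_free_word :: "'a free_word \<Rightarrow> 'a free_word \<Rightarrow> 'a free_word" where
  "v + w = Word (letters v @ letters w)"

instance
  by standard (auto simp: zero_free_word_def plus_free_word_def)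

end

type_synonym 'x nc_poly = "'x free_word \<Rightarrow>\<^sub>0 int"

definition monomial_of :: "'x free_word \<Rightarrow> 'x nc_poly" where
  "monomial_of w = Poly_Mapping.single w 1"

datatype ab_letter = LA | LB

datatype cd_letter = LC | LD

abbreviation a_var :: "ab_letter nc_poly" where
  "a_var \<equiv> monomial_of (Word [LA])"

abbreviation b_var :: "ab_letter nc_poly" where
  "b_var \<equiv> monomial_of (Word [LB])"

section \<open>The ab-index and the cd-index\<close>

text \<open>A chain containing the minimum and the maximum is represented by the strictly
  increasing list \<open>[x\<^sub>0, \<dots>, x\<^sub>k\<^sub>+\<^sub>1]\<close> of its elements.\<close>

definition full_chains :: "'a rel \<Rightarrow> 'a list set" where
  "full_chains r =
     {xs. xs \<noteq> [] \<and> set xs \<subseteq> Field r \<and> sorted_wrt (\<lambda>x y. (x, y) \<in> r \<and> x \<noteq> y) xs \<and>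
          least_in r (hd xs) \<and> greatest_in r (last xs)}"

text \<open>Lists with fewer than two elements get a dummy weight; they do not arise from posets
  of rank at least one.\<close>

fun chain_wt :: "('a \<Rightarrow> int) \<Rightarrow> 'a list \<Rightarrow> ab_letter nc_poly" where
  "chain_wt \<rho> (x # y # z # zs) =
     (a_var - b_var) ^ nat (\<rho> y - \<rho> x - 1) * b_var * chain_wt \<rho> (y # z # zs)"
| "chain_wt \<rho> [x, y] = (a_var - b_var) ^ nat (\<rho> y - \<rho> x - 1)"
| "chain_wt \<rho> _ = 1"

definition ab_index :: "'a rel \<Rightarrow> ('a \<Rightarrow> int) \<Rightarrow> ab_letter nc_poly" where
  "ab_index r \<rho> = (\<Sum>xs\<in>full_chains r. chain_wt \<rho> xs)"

fun cd_letter_value :: "cd_letter \<Rightarrow> ab_letter nc_poly" where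
  "cd_letter_value LC = a_var + b_var"
| "cd_letter_value LD = a_var * b_var + b_var * a_var"

definition cd_subst :: "cd_letter nc_poly \<Rightarrow> ab_letter nc_poly" where
  "cd_subst p =
     (\<Sum>w\<in>Poly_Mapping.keys p.
        of_int (Poly_Mapping.lookup p w) * prod_list (map cd_letter_value (letters w)))"

definition cd_index :: "'a rel \<Rightarrow> ('a \<Rightarrow> int) \<Rightarrow> cd_letter nc_poly" where
  "cd_index r \<rho> = (THE p. cd_subst p = ab_index r \<rho>)"

fun cd_letter_degree :: "cd_letter \<Rightarrow> nat" where
  "cd_letter_degree LC = 1"
| "cd_letter_degree LD = 2"

definition cd_degree :: "cd_letter free_word \<Rightarrow> nat" where
  "cd_degree w = sum_list (map cd_letter_degree (letters w))"

section \<open>The matrix\<close>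

text \<open>The index type \<open>4\<close> has the elements \<open>1, 2, 3, 4\<close> (with \<open>4 = 0\<close>), and
  \<^const>\<open>vector\<close> numbers its entries from 1.\<close>

definition M\<^sub>4 :: "nat ^ 4 ^ 4" where
  "M\<^sub>4 = vector [vector [1, 1, 1, 0],
                 vector [1, 0, 1, 1],
                 vector [0, 1, 0, 1],
                 vector [1, 0, 1, 1]]"

end

theory Submission
  imports Defs
begin

text \<open>Cutting the chains of \<open>[(u, 0), (1, n)]\<close> after their first step gives a renewal recursion
  for the \<open>ab\<close>-index. The powers of the matrix are positive from the third on, so with \<open>e = a - b\<close>
  the recursion has the kernel \<open>e\<^sup>l\<^sup>-\<^sup>1 b\<close>, weighted by the sum over all four rows, up to corrections
  in the first two terms. Its solution is \<open>x\<^sub>n\<close> for \<open>u \<noteq> 3\<close> and \<open>(a + b) x\<^sub>n\<^sub>-\<^sub>1\<close> for \<open>u = 3\<close>, where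
  \<open>x\<^sub>0 = 0\<close>, \<open>x\<^sub>1 = 1\<close> and \<open>x\<^sub>n = c x\<^sub>n\<^sub>-\<^sub>1 + d x\<^sub>n\<^sub>-\<^sub>2\<close>; splitting off the first letter shows that the sum
  of all \<open>cd\<close>-monomials of degree \<open>n - 1\<close> satisfies the same recursion.\<close>

section \<open>Intervals of level posets\<close>

lemma interval_interval_poset:
  assumes "trans r" "(a, b) \<in> interval_poset r x y"
  shows "interval (interval_poset r x y) a b = interval r a b"
  using assms unfolding interval_poset_def interval_def by (auto dest: transD)

lemma Field_interval_poset:
  assumes "refl r"
  shows "Field (interval_poset r x y) = interval r x y"
  using assms unfolding interval_poset_def Field_def by (auto dest: reflD)

lemma partial_order_on_interval_poset:
  assumes "refl r" "trans r" "antisym r"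
  shows "partial_order_on (interval r x y) (interval_poset r x y)"
  using assms unfolding order_on_defs
  by (auto simp: interval_poset_def refl_on_def antisym_def dest: reflD intro: trans_Restr)

lemma least_in_interval_poset_iff:
  assumes "refl r" "antisym r" "(x, y) \<in> r"
  shows "least_in (interval_poset r x y) z \<longleftrightarrow> z = x"
  using assms unfolding least_in_def Field_interval_poset[OF assms(1)]
  by (auto simp: interval_poset_def interval_def dest: reflD antisymD)

lemma greatest_in_interval_poset_iff:
  assumes "refl r" "antisym r" "(x, y) \<in> r"
  shows "greatest_in (interval_poset r x y) z \<longleftrightarrow> z = y"
  using assms unfolding greatest_in_def Field_interval_poset[OF assms(1)]
  by (auto simp: interval_poset_def interval_def dest: reflD antisymD)

section \<open>Powers of the matrix and the order of a level poset\<close>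

lemma matpow_add: "matpow M (m + n) = matpow M m ** matpow M n"
  by (induction n) (simp_all add: matrix_mul_assoc del: One_nat_def)

text \<open>Entries are natural numbers, so nothing cancels: one positive summand makes an entry of
  a product positive. Positivity of powers thus composes like relations.\<close>

lemma matpow_add_pos_iff:
  "matpow M (m + n) $ u $ v > 0 \<longleftrightarrow>
     (\<exists>w. matpow M m $ u $ w > 0 \<and> matpow M n $ w $ v > 0)"
  by (auto simp: matpow_add matrix_matrix_mult_def sum_nonneg_eq_0_iff simp flip: neq0_conv)

lemma matpow_1: "matpow M 1 = M"
  using matpow.simps(2)[of M 0] by (simp del: One_nat_def matpow.simps(2) add: Suc_eq_plus1)

text \<open>Since the zeroth power is the identity matrix, the diagonal needs no separate case.\<close>

lemma level_poset_iff:
  "((u, i), (v, j)) \<in> level_poset M \<longleftrightarrow> i \<le> j \<and> matpow M (nat (j - i)) $ u $ v > 0"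
  by (cases "i = j") (auto simp: level_poset_def mat_def)

lemma level_poset_add_iff:
  "((u, i), (v, i + int k)) \<in> level_poset M \<longleftrightarrow> matpow M k $ u $ v > 0"
  by (simp add: level_poset_iff)

lemma level_poset_cases:
  assumes "(x, y) \<in> level_poset M"
  obtains u i v k where "x = (u, i)" "y = (v, i + int k)" "matpow M k $ u $ v > 0"
proof -
  obtain u i v j where xy: "x = (u, i)" "y = (v, j)" by fastforce
  with assms have "i \<le> j" "matpow M (nat (j - i)) $ u $ v > 0"
    by (simp_all add: level_poset_iff)
  with xy show thesis by (intro that[of u i v "nat (j - i)"]) auto
qed

lemma refl_level_poset: "refl (level_poset M)"
  by (auto intro!: reflI simp: level_poset_def)

lemma antisym_level_poset: "antisym (level_poset M)"
  by (auto intro!: antisymI simp: level_poset_def)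

lemma trans_level_poset: "trans (level_poset M)"
proof (rule transI)
  fix x y z assume xy: "(x, y) \<in> level_poset M" and yz: "(y, z) \<in> level_poset M"
  from xy obtain u i v k where x: "x = (u, i)" and y: "y = (v, i + int k)"
    and uv: "matpow M k $ u $ v > 0"
    by (elim level_poset_cases)
  from yz obtain w l where z: "z = (w, i + int k + int l)" and vw: "matpow M l $ v $ w > 0"
    unfolding y by (elim level_poset_cases) auto
  from uv vw have "matpow M (k + l) $ u $ w > 0" unfolding matpow_add_pos_iff by blast
  then show "(x, z) \<in> level_poset M"
    unfolding x z add.assoc of_nat_add[symmetric] level_poset_add_iff .
qed

lemmas level_poset_order = refl_level_poset trans_level_poset antisym_level_poset

text \<open>Pairs are listed as (level, row), so that a sum over the open interval becomes a sum
  over levels of sums over rows.\<close>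

lemma open_interval_level_poset:
  "interval (level_poset M) (u, i) (v, i + int k) - {(u, i), (v, i + int k)} =
   (\<lambda>(l, w). (w, i + int l)) `
     (SIGMA l:{1..<k}. {w. matpow M l $ u $ w > 0 \<and> matpow M (k - l) $ w $ v > 0})"
    (is "?L = ?R")
proof (intro subset_antisym subsetI)
  fix z assume z: "z \<in> ?L"
  then have "((u, i), z) \<in> level_poset M" by (auto simp: interval_def)
  then obtain l w where zl: "z = (w, i + int l)" "matpow M l $ u $ w > 0"
    by (elim level_poset_cases) auto
  with z have "l \<le> k" and kl: "matpow M (k - l) $ w $ v > 0"
    by (auto simp: interval_def level_poset_iff nat_diff_distrib simp flip: of_nat_diff)
  \<comment> \<open>On either extreme level the remaining power is the identity matrix, which would
    make \<open>z\<close> an endpoint.\<close>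
  moreover have "l \<noteq> 0"
    using z zl by (intro notI) (simp add: mat_def split: if_splits)
  moreover have "l \<noteq> k"
    using z zl kl by (intro notI) (simp add: mat_def split: if_splits)
  ultimately show "z \<in> ?R"
    using zl by (intro image_eqI[of _ _ "(l, w)"]) auto
next
  fix z assume "z \<in> ?R"
  then obtain l w where z: "z = (w, i + int l)" and l: "0 < l" "l < k"
    and uw: "matpow M l $ u $ w > 0" and wv: "matpow M (k - l) $ w $ v > 0"
    by auto
  have "((u, i), z) \<in> level_poset M"
    unfolding z level_poset_add_iff by (rule uw)
  moreover have "(z, (v, i + int k)) \<in> level_poset M"
    using wv l level_poset_add_iff[of w "i + int l" v "k - l" M] by (simp add: z)
  ultimately show "z \<in> ?L"
    using l by (simp add: interval_def z)
qed

lemma inj_level_coordinates: "inj_on (\<lambda>(l, w). (w, i + int l)) S"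
  by (auto simp: inj_on_def)

lemma finite_interval_level_poset: "finite (interval (level_poset M) x y)"
proof (cases "(x, y) \<in> level_poset M")
  case True
  then obtain u i v k where "x = (u, i)" "y = (v, i + int k)"
    by (elim level_poset_cases)
  then have "finite (interval (level_poset M) x y - {x, y})"
    by (simp add: open_interval_level_poset)
  then show ?thesis by simp
next
  case False
  then have "interval (level_poset M) x y = {}"
    using trans_level_poset[of M] by (auto simp: interval_def dest: transD)
  then show ?thesis by simp
qed

lemma sum_open_interval_level_poset:
  "(\<Sum>z\<in>interval (level_poset M) (u, i) (v, i + int k) - {(u, i), (v, i + int k)}. f z) =
   (\<Sum>l=1..<k. \<Sum>w | matpow M l $ u $ w > 0 \<and> matpow M (k - l) $ w $ v > 0. f (w, i + int l))"
  unfolding open_interval_level_poset sum.reindex[OF inj_level_coordinates]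
  by (simp add: sum.Sigma comp_def case_prod_unfold)

text \<open>A gap of \<open>k >= 2\<close> levels is never a cover: splitting the power as
  \<open>1 + (k - 1)\<close> yields an element strictly in between, one level above
  \<open>a\<close>.\<close>

lemma covers_level_poset_interval:
  assumes "covers (interval_poset (level_poset M) x y) b a"
  shows "snd b = snd a + 1"
proof -
  from assms have ab: "(a, b) \<in> interval_poset (level_poset M) x y" "a \<noteq> b"
    by (simp_all add: covers_def)
  from assms have int: "interval (level_poset M) a b = {a, b}"
    unfolding covers_def interval_interval_poset[OF trans_level_poset ab(1)] by simp
  from ab have "(a, b) \<in> level_poset M" by (simp add: interval_poset_def)
  then obtain u i v k where k: "a = (u, i)" "b = (v, i + int k)" "matpow M k $ u $ v > 0"
    by (elim level_poset_cases)
  with ab have "k \<noteq> 0" by (intro notI) (simp add: mat_def split: if_splits)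
  moreover have "\<not> 2 \<le> k"
  proof
    assume "2 \<le> k"
    then have "matpow M (1 + (k - 1)) $ u $ v > 0" using k by simp
    then obtain w where "matpow M 1 $ u $ w > 0" "matpow M (k - 1) $ w $ v > 0"
      using matpow_add_pos_iff by blast
    with \<open>2 \<le> k\<close> have "(w, i + int 1) \<in> interval (level_poset M) a b - {a, b}"
      unfolding k open_interval_level_poset by (intro image_eqI[of _ _ "(1, w)"]) auto
    with int show False by simp
  qed
  ultimately have "k = 1" by linarith
  with k show ?thesis by simp
qed

lemma finite_graded_level_poset_interval:
  assumes "(x, y) \<in> level_poset M"
  shows "finite_graded_poset (interval_poset (level_poset M) x y) snd"
  unfolding finite_graded_poset_def
  using covers_level_poset_interval[of M x y]
  unfolding Field_interval_poset[OF refl_level_poset]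
    least_in_interval_poset_iff[OF refl_level_poset antisym_level_poset assms]
    greatest_in_interval_poset_iff[OF refl_level_poset antisym_level_poset assms]
  by (simp add: partial_order_on_interval_poset level_poset_order finite_interval_level_poset)

text \<open>Intervals of an interval are intervals of the level poset, and the starting level only
  contributes the factor \<open>(-1) powi i\<close>. What remains is a count by levels, in which 1
  and \<open>(-1) ^ k\<close> belong to the endpoints.\<close>

lemma level_eulerianI:
  fixes M :: "nat ^ 'v ^ 'v"
  assumes "\<And>u v k. \<lbrakk>k \<ge> 1; matpow M k $ u $ v > 0\<rbrakk> \<Longrightarrow>
    1 + (-1) ^ k + (\<Sum>l=1..<k. (-1) ^ l *
      of_nat (card {w. matpow M l $ u $ w > 0 \<and> matpow M (k - l) $ w $ v > 0})) = (0 :: rat)"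
  shows "level_eulerian M"
  unfolding level_eulerian_def eulerian_def
proof (intro allI impI conjI)
  fix x y assume "(x, y) \<in> level_poset M"
  then show "finite_graded_poset (interval_poset (level_poset M) x y) snd"
    by (rule finite_graded_level_poset_interval)
next
  fix x y a b :: "'v \<times> int"
  assume ab: "(a, b) \<in> interval_poset (level_poset M) x y \<and> snd b - snd a \<ge> 1"
  then have lp: "(a, b) \<in> level_poset M" by (simp add: interval_poset_def)
  then obtain u i v k where k: "a = (u, i)" "b = (v, i + int k)" "matpow M k $ u $ v > 0"
    by (elim level_poset_cases)
  with ab have "k \<ge> 1" by simp
  let ?I = "interval (level_poset M) a b" and ?f = "\<lambda>z. (-1 :: rat) powi snd z"
  have "{a, b} \<subseteq> ?I"
    using lp by (auto simp: interval_def intro: reflD[OF refl_level_poset])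
  then have "sum ?f ?I = sum ?f (?I - {a, b}) + sum ?f {a, b}"
    by (rule sum.subset_diff[OF _ finite_interval_level_poset])
  also have "\<dots> = (-1) powi i * (1 + (-1) ^ k + (\<Sum>l=1..<k. (-1) ^ l *
      of_nat (card {w. matpow M l $ u $ w > 0 \<and> matpow M (k - l) $ w $ v > 0})))"
    unfolding k sum_open_interval_level_poset using \<open>k \<ge> 1\<close>
    by (simp add: power_int_add algebra_simps sum_distrib_left)
  also have "\<dots> = 0"
    using assms[OF \<open>k \<ge> 1\<close> k(3)] by simp
  finally show "sum ?f (interval (interval_poset (level_poset M) x y) a b) = 0"
    using ab by (simp add: interval_interval_poset trans_level_poset)
qed

section \<open>Chains and the ab-index\<close>

text \<open>Phrased in the ambient order rather than in an interval poset, so that the nonempty tail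
  of a chain is again such a chain with the same top.\<close>

definition chains_between :: "'a rel \<Rightarrow> 'a \<Rightarrow> 'a \<Rightarrow> 'a list set" where
  "chains_between r x y =
     {xs. xs \<noteq> [] \<and> hd xs = x \<and> last xs = y \<and> sorted_wrt (\<lambda>x y. (x, y) \<in> r \<and> x \<noteq> y) xs}"

lemma sorted_wrt_hd: "sorted_wrt R xs \<Longrightarrow> z \<in> set xs \<Longrightarrow> z = hd xs \<or> R (hd xs) z"
  by (cases xs) auto

lemma sorted_wrt_last: "sorted_wrt R xs \<Longrightarrow> z \<in> set xs \<Longrightarrow> z = last xs \<or> R z (last xs)"
  by (cases xs rule: rev_cases) (auto simp: sorted_wrt_append)

lemma set_chain_subset:
  assumes "refl r" "xs \<in> chains_between r x y"
  shows "set xs \<subseteq> interval r x y"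
proof
  fix z assume "z \<in> set xs"
  with assms show "z \<in> interval r x y"
    using sorted_wrt_hd[of _ xs z] sorted_wrt_last[of _ xs z]
    by (fastforce simp: chains_between_def interval_def dest: reflD)
qed

lemma distinct_chain: "xs \<in> chains_between r x y \<Longrightarrow> distinct xs"
  unfolding chains_between_def distinct_conv_nth
  by (auto simp: sorted_wrt_iff_nth_less) (metis linorder_neqE_nat)

lemma finite_chains_between:
  assumes "refl r" "finite (interval r x y)"
  shows "finite (chains_between r x y)"
  by (rule finite_subset[OF _ finite_subset_distinct[OF assms(2)]])
    (use set_chain_subset[OF assms(1)] distinct_chain in fastforce)

text \<open>Chains are classified by their second element, which is \<open>y\<close> or lies
  strictly in between.\<close>

lemma chains_between_step:
  assumes "trans r" "antisym r" "(x, y) \<in> r" "x \<noteq> y"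
  shows "chains_between r x y =
    insert [x, y] (\<Union>z\<in>interval r x y - {x, y}. (#) x ` chains_between r z y)"
    (is "?L = ?R")
proof (intro subset_antisym subsetI)
  fix xs assume "xs \<in> ?L"
  then obtain zs where xs: "xs = x # zs" and zs: "zs \<noteq> []" "last zs = y"
    and sorted: "\<forall>z\<in>set zs. (x, z) \<in> r \<and> x \<noteq> z"
      "sorted_wrt (\<lambda>x y. (x, y) \<in> r \<and> x \<noteq> y) zs"
    using assms(4) by (cases xs) (auto simp: chains_between_def split: if_splits)
  have hd: "(x, hd zs) \<in> r" "x \<noteq> hd zs" using zs sorted by simp_all
  have "hd zs = y \<or> (hd zs, y) \<in> r \<and> hd zs \<noteq> y"
    using sorted_wrt_last[OF sorted(2), of "hd zs"] zs by auto
  then show "xs \<in> ?R"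
  proof
    assume "hd zs = y"
    then have "zs = [y]"
      using zs sorted(2) by (cases zs) (auto split: if_splits)
    then show ?thesis by (simp add: xs)
  next
    assume "(hd zs, y) \<in> r \<and> hd zs \<noteq> y"
    then have "hd zs \<in> interval r x y - {x, y}" using hd by (auto simp: interval_def)
    moreover have "zs \<in> chains_between r (hd zs) y"
      using zs sorted by (simp add: chains_between_def)
    ultimately show ?thesis unfolding xs by blast
  qed
next
  fix xs assume "xs \<in> ?R"
  then consider "xs = [x, y]" | z zs where "xs = x # zs" "(x, z) \<in> r" "(z, y) \<in> r"
      "z \<noteq> x" "z \<noteq> y" "zs \<in> chains_between r z y"
    by (auto simp: interval_def)
  then show "xs \<in> ?L"
  proof cases
    case 1
    with assms show ?thesis by (simp add: chains_between_def)
  next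
    case 2
    have "(x, w) \<in> r \<and> x \<noteq> w" if "w \<in> set zs" for w
      using sorted_wrt_hd[of _ zs w] that 2 assms(1,2)
      by (fastforce simp: chains_between_def dest: transD antisymD)
    with 2 show ?thesis by (auto simp: chains_between_def)
  qed
qed

text \<open>Since \<open>z \<noteq> y\<close>, the list \<open>zs\<close> has at least two elements,
  so the recursive equation of \<open>chain_wt\<close> applies.\<close>

lemma chain_wt_Cons:
  assumes "zs \<in> chains_between r z y" "z \<noteq> y"
  shows "chain_wt \<rho> (x # zs) = (a_var - b_var) ^ nat (\<rho> z - \<rho> x - 1) * b_var * chain_wt \<rho> zs"
proof -
  from assms obtain w ws where "zs = z # w # ws"
    by (cases zs; cases "tl zs") (auto simp: chains_between_def)
  then show ?thesis by simp
qed

definition ab_between :: "'a rel \<Rightarrow> ('a \<Rightarrow> int) \<Rightarrow> 'a \<Rightarrow> 'a \<Rightarrow> ab_letter nc_poly" where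
  "ab_between r \<rho> x y = (\<Sum>xs\<in>chains_between r x y. chain_wt \<rho> xs)"

lemma ab_between_step:
  assumes "refl r" "trans r" "antisym r" "(x, y) \<in> r" "x \<noteq> y"
    and fin: "\<And>z. finite (interval r z y)"
  shows "ab_between r \<rho> x y = (a_var - b_var) ^ nat (\<rho> y - \<rho> x - 1) +
    (\<Sum>z\<in>interval r x y - {x, y}.
       (a_var - b_var) ^ nat (\<rho> z - \<rho> x - 1) * b_var * ab_between r \<rho> z y)"
proof -
  let ?I = "interval r x y - {x, y}"
  let ?C = "\<lambda>z. (#) x ` chains_between r z y"
  have finC: "finite (chains_between r z y)" for z
    using finite_chains_between[OF assms(1) fin] .
  have "[x, y] \<notin> (\<Union>z\<in>?I. ?C z)"
    by (auto simp: chains_between_def)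
  then have "ab_between r \<rho> x y =
      (a_var - b_var) ^ nat (\<rho> y - \<rho> x - 1) + sum (chain_wt \<rho>) (\<Union>z\<in>?I. ?C z)"
    unfolding ab_between_def chains_between_step[OF assms(2-5)]
    using fin finC by (subst sum.insert) auto
  \<comment> \<open>The pieces are disjoint because the second entry of a chain determines
    \<open>z\<close>.\<close>
  also have "sum (chain_wt \<rho>) (\<Union>z\<in>?I. ?C z) = (\<Sum>z\<in>?I. sum (chain_wt \<rho>) (?C z))"
    using fin finC by (intro sum.UNION_disjoint) (auto simp: chains_between_def)
  also have "\<dots> = (\<Sum>z\<in>?I.
      (a_var - b_var) ^ nat (\<rho> z - \<rho> x - 1) * b_var * ab_between r \<rho> z y)"
    by (intro sum.cong refl)
      (auto simp: sum.reindex ab_between_def sum_distrib_left intro!: sum.cong chain_wt_Cons)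
  finally show ?thesis .
qed

lemma full_chains_interval_poset:
  assumes "refl r" "antisym r" "(x, y) \<in> r"
  shows "full_chains (interval_poset r x y) = chains_between r x y"
proof -
  have "sorted_wrt (\<lambda>v w. (v, w) \<in> interval_poset r x y \<and> v \<noteq> w) xs \<longleftrightarrow>
      sorted_wrt (\<lambda>v w. (v, w) \<in> r \<and> v \<noteq> w) xs" if "set xs \<subseteq> interval r x y" for xs
    using that by (induction xs) (auto simp: interval_poset_def)
  then show ?thesis
    using set_chain_subset[OF assms(1), of _ x y]
    unfolding full_chains_def Field_interval_poset[OF assms(1)]
      least_in_interval_poset_iff[OF assms] greatest_in_interval_poset_iff[OF assms]
      chains_between_def
    by blast
qed

lemma ab_between_level_poset_step:
  assumes "k > 0" "matpow M k $ u $ v > 0"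
  shows "ab_between (level_poset M) snd (u, i) (v, i + int k) = (a_var - b_var) ^ (k - 1) +
    (\<Sum>l=1..<k. \<Sum>w | matpow M l $ u $ w > 0 \<and> matpow M (k - l) $ w $ v > 0.
       (a_var - b_var) ^ (l - 1) * b_var *
         ab_between (level_poset M) snd (w, i + int l) (v, i + int k))"
proof -
  have lp: "((u, i), (v, i + int k)) \<in> level_poset M" "(u, i) \<noteq> (v, i + int k)"
    using assms by (simp_all add: level_poset_add_iff)
  have "nat (int m - 1) = m - 1" for m by simp
  then show ?thesis
    unfolding ab_between_step[OF refl_level_poset trans_level_poset antisym_level_poset lp
        finite_interval_level_poset] sum_open_interval_level_poset
    by simp
qed

section \<open>Uniqueness of the cd-index\<close>

text \<open>Lets several polynomials be expanded over one common set of words, as needed for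
  additivity.\<close>

lemma cd_subst_eq_sum:
  assumes "finite S" "Poly_Mapping.keys p \<subseteq> S"
  shows "cd_subst p =
    (\<Sum>w\<in>S. of_int (Poly_Mapping.lookup p w) * prod_list (map cd_letter_value (letters w)))"
  unfolding cd_subst_def using assms by (intro sum.mono_neutral_left) (auto simp: in_keys_iff)

lemma cd_subst_add: "cd_subst (p + q) = cd_subst p + cd_subst q"
proof -
  let ?S = "Poly_Mapping.keys p \<union> Poly_Mapping.keys q"
  have "Poly_Mapping.keys (p + q) \<subseteq> ?S" by (rule keys_add)
  then show ?thesis
    by (simp add: cd_subst_eq_sum[of ?S] lookup_add distrib_right sum.distrib)
qed

lemma cd_subst_0: "cd_subst 0 = 0"
  by (simp add: cd_subst_def)

lemma cd_subst_diff: "cd_subst (p - q) = cd_subst p - cd_subst q"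
  using cd_subst_add[of "p - q" q] by simp

lemma cd_subst_sum: "cd_subst (\<Sum>i\<in>S. f i) = (\<Sum>i\<in>S. cd_subst (f i))"
  by (induction S rule: infinite_finite_induct) (simp_all add: cd_subst_0 cd_subst_add)

lemma cd_subst_single:
  "cd_subst (Poly_Mapping.single w k) = of_int k * prod_list (map cd_letter_value (letters w))"
  by (simp add: cd_subst_def)

lemma monomial_of_letter_times_single:
  "monomial_of (Word [x]) * Poly_Mapping.single w k = Poly_Mapping.single (Word (x # letters w)) k"
  by (simp add: monomial_of_def mult_single plus_free_word_def)

lemma poly_mapping_additive_induct [case_names zero single add]:
  fixes p :: "'a \<Rightarrow>\<^sub>0 'b::comm_monoid_add"
  assumes "P 0" "\<And>w k. P (Poly_Mapping.single w k)" "\<And>p q. P p \<Longrightarrow> P q \<Longrightarrow> P (p + q)"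
  shows "P p"
proof -
  have "P (\<Sum>w\<in>S. Poly_Mapping.single w (Poly_Mapping.lookup p w))" for S
    by (induction S rule: infinite_finite_induct) (use assms in auto)
  moreover have "p = (\<Sum>w\<in>Poly_Mapping.keys p. Poly_Mapping.single w (Poly_Mapping.lookup p w))"
    by (intro poly_mapping_eqI)
      (auto simp: lookup_sum lookup_single when_def in_keys_iff)
  ultimately show ?thesis by metis
qed

lemma of_int_nc_poly: "(of_int k :: 'x nc_poly) = Poly_Mapping.single 0 k"
  using single_of_int[where ?'a = "'x free_word" and ?'b = int, of k] by (simp add: of_int_eq_id)

text \<open>Integer coefficients are central, which lets them move past letters.\<close>

lemma of_int_nc_poly_commute: "of_int k * p = p * (of_int k :: 'x nc_poly)"
  by (induction p rule: poly_mapping_additive_induct)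
    (simp_all add: of_int_nc_poly mult_single algebra_simps)

lemma cd_subst_letter_times:
  "cd_subst (monomial_of (Word [x]) * p) = cd_letter_value x * cd_subst p"
proof (induction p rule: poly_mapping_additive_induct)
  case (single w k)
  have "of_int k * (cd_letter_value x * q) = cd_letter_value x * (of_int k * q)" for q
    by (metis mult.assoc of_int_nc_poly_commute)
  then show ?case by (simp add: monomial_of_letter_times_single cd_subst_single)
qed (simp_all add: cd_subst_0 cd_subst_add distrib_left)

lemma lookup_letter_times:
  "Poly_Mapping.lookup (monomial_of (Word [x]) * p) (Word []) = 0"
  "Poly_Mapping.lookup (monomial_of (Word [x]) * p) (Word (y # ys)) =
     (if x = y then Poly_Mapping.lookup p (Word ys) else 0)"
proof (induction p rule: poly_mapping_additive_induct)
  case (single w k)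
  {
    case 1
    then show ?case by (simp add: monomial_of_letter_times_single lookup_single when_def)
  next
    case 2
    then show ?case
      by (cases w) (simp add: monomial_of_letter_times_single lookup_single when_def)
  }
qed (simp_all add: lookup_add distrib_left)

lemma nc_poly_first_letter_decomp:
  "\<exists>k q. p = of_int k + (\<Sum>x\<in>UNIV. monomial_of (Word [x :: 'x::finite]) * q x)"
proof (induction p rule: poly_mapping_additive_induct)
  case zero
  show ?case by (intro exI[of _ 0] exI[of _ "\<lambda>_. 0"]) simp
next
  case (single w k)
  show ?case
  proof (cases "letters w")
    case Nil
    then have "w = 0" by (cases w) (simp add: zero_free_word_def)
    then show ?thesis
      by (intro exI[of _ k] exI[of _ "\<lambda>_. 0"]) (simp add: of_int_nc_poly)
  next
    case (Cons y ys)
    then have w: "w = Word (y # ys)" by (cases w) simp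
    have "(\<Sum>x\<in>UNIV. monomial_of (Word [x]) * (if x = y then Poly_Mapping.single (Word ys) k else 0)) =
        Poly_Mapping.single w k"
      by (simp add: w if_distrib monomial_of_letter_times_single cong: if_cong)
    then show ?thesis
      by (intro exI[of _ 0] exI[of _ "\<lambda>x. if x = y then Poly_Mapping.single (Word ys) k else 0"]) simp
  qed
next
  case (add p p')
  then obtain k q k' q' where
    "p = of_int k + (\<Sum>x\<in>UNIV. monomial_of (Word [x]) * q x)"
    "p' = of_int k' + (\<Sum>x\<in>UNIV. monomial_of (Word [x]) * q' x)" by auto
  then show ?case
    by (intro exI[of _ "k + k'"] exI[of _ "\<lambda>x. q x + q' x"]) (simp add: distrib_left sum.distrib)
qed

lemma UNIV_cd_letter: "UNIV = {LC, LD}"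
  by (auto intro: cd_letter.exhaust)

instance cd_letter :: finite
  by standard (simp add: UNIV_cd_letter)

text \<open>The three summands live on disjoint sets of words: the empty word, words starting with
  a, words starting with b.\<close>

lemma letter_times_add_eq_0D:
  assumes "of_int k + a_var * p + b_var * q = 0"
  shows "k = 0" "p = 0" "q = 0"
proof -
  have *: "Poly_Mapping.lookup (of_int k + a_var * p + b_var * q) w = 0" for w
    by (simp add: assms)
  show "k = 0"
    using *[of "Word []"]
    by (simp add: lookup_add lookup_letter_times of_int_nc_poly lookup_single zero_free_word_def)
  have "Poly_Mapping.lookup p (Word ys) = 0" "Poly_Mapping.lookup q (Word ys) = 0" for ys
    using *[of "Word (LA # ys)"] *[of "Word (LB # ys)"]
    by (simp_all add: lookup_add lookup_letter_times of_int_nc_poly lookup_single zero_free_word_def)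
  then show "p = 0" "q = 0"
    by (auto intro!: poly_mapping_eqI) (metis free_word.exhaust)+
qed

text \<open>Here \<open>c P + d Q = a (P + b Q) + b (P + a Q)\<close>, so if this vanishes then \<open>a Q = b Q\<close>.\<close>

lemma cd_subst_eq_0_decomp:
  assumes "cd_subst (of_int k + monomial_of (Word [LC]) * p + monomial_of (Word [LD]) * q) = 0"
  shows "k = 0 \<and> cd_subst p = 0 \<and> cd_subst q = 0"
proof -
  let ?P = "cd_subst p" and ?Q = "cd_subst q"
  have "cd_subst (of_int k) = of_int k"
    by (simp add: of_int_nc_poly cd_subst_single zero_free_word_def)
  with assms have "of_int k + a_var * (?P + b_var * ?Q) + b_var * (?P + a_var * ?Q) = 0"
    by (simp add: cd_subst_add cd_subst_letter_times algebra_simps)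
  from letter_times_add_eq_0D[OF this]
  have "k = 0" and P: "?P + b_var * ?Q = 0" "?P + a_var * ?Q = 0" .
  from P have "a_var * ?Q = b_var * ?Q" by (metis add_left_cancel)
  then have "of_int 0 + a_var * ?Q + b_var * (- ?Q) = 0" by simp
  with letter_times_add_eq_0D(2) have "?Q = 0" by blast
  with P \<open>k = 0\<close> show ?thesis by simp
qed

lemma cd_subst_eq_0E:
  assumes "cd_subst p = 0"
  obtains q\<^sub>C q\<^sub>D where "p = monomial_of (Word [LC]) * q\<^sub>C + monomial_of (Word [LD]) * q\<^sub>D"
    "cd_subst q\<^sub>C = 0" "cd_subst q\<^sub>D = 0"
proof -
  obtain k q where "p = of_int k + (\<Sum>x\<in>UNIV. monomial_of (Word [x]) * q x)"
    using nc_poly_first_letter_decomp by blast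
  then have p: "p = of_int k + monomial_of (Word [LC]) * q LC + monomial_of (Word [LD]) * q LD"
    by (simp add: UNIV_cd_letter add.assoc)
  from cd_subst_eq_0_decomp[OF assms[unfolded p]] that[of "q LC" "q LD"] show thesis
    by (simp add: p)
qed

text \<open>This is freeness of c and d. A kernel element has no constant term, and stripping the
  first letter gives kernel elements again, so every coefficient vanishes by induction on the
  word.\<close>

lemma cd_subst_eq_0D:
  assumes "cd_subst p = 0"
  shows "p = 0"
proof -
  have "Poly_Mapping.lookup p (Word ws) = 0" for ws
    using assms
  proof (induction ws arbitrary: p)
    case Nil
    then obtain q\<^sub>C q\<^sub>D where
      "p = monomial_of (Word [LC]) * q\<^sub>C + monomial_of (Word [LD]) * q\<^sub>D"
      by (rule cd_subst_eq_0E)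
    then show ?case by (simp add: lookup_add lookup_letter_times)
  next
    case (Cons y ys)
    from Cons.prems obtain q\<^sub>C q\<^sub>D where
      "p = monomial_of (Word [LC]) * q\<^sub>C + monomial_of (Word [LD]) * q\<^sub>D"
      "cd_subst q\<^sub>C = 0" "cd_subst q\<^sub>D = 0"
      by (rule cd_subst_eq_0E)
    with Cons.IH show ?case
      by (cases y) (simp_all add: lookup_add lookup_letter_times)
  qed
  then have "Poly_Mapping.lookup p w = 0" for w
    by (cases w) simp
  then show ?thesis by (intro poly_mapping_eqI) simp
qed

lemma cd_index_eqI:
  assumes "cd_subst p = ab_index r \<rho>"
  shows "cd_index r \<rho> = p"
  unfolding cd_index_def
proof (rule the_equality)
  fix q assume "cd_subst q = ab_index r \<rho>"
  with assms have "cd_subst (q - p) = 0" by (simp add: cd_subst_diff)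
  then show "q = p" using cd_subst_eq_0D by force
qed (rule assms)

section \<open>Words of given degree in c and d\<close>

lemma cd_degree_Cons: "cd_degree (Word (x # xs)) = cd_letter_degree x + cd_degree (Word xs)"
  by (simp add: cd_degree_def)

lemma cd_words_step:
  "{w. cd_degree w = Suc (Suc m)} =
     (\<lambda>w. Word (LC # letters w)) ` {w. cd_degree w = Suc m} \<union>
     (\<lambda>w. Word (LD # letters w)) ` {w. cd_degree w = m}"
proof (intro subset_antisym subsetI)
  fix w assume w: "w \<in> {w. cd_degree w = Suc (Suc m)}"
  then obtain x xs where xs: "w = Word (x # xs)"
    by (cases w; cases "letters w") (auto simp: cd_degree_def)
  show "w \<in> (\<lambda>w. Word (LC # letters w)) ` {w. cd_degree w = Suc m} \<union>
     (\<lambda>w. Word (LD # letters w)) ` {w. cd_degree w = m}"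
  proof (cases x)
    case LC
    with w xs show ?thesis
      by (intro UnI1 image_eqI[of _ _ "Word xs"]) (simp_all add: cd_degree_Cons)
  next
    case LD
    with w xs show ?thesis
      by (intro UnI2 image_eqI[of _ _ "Word xs"]) (simp_all add: cd_degree_Cons)
  qed
qed (auto simp: cd_degree_def)

lemma cd_words_0: "{w. cd_degree w = 0} = {Word []}"
proof -
  have "cd_degree (Word xs) = 0 \<longleftrightarrow> xs = []" for xs
  proof (cases xs)
    case (Cons x ys)
    then show ?thesis by (cases x) (simp_all add: cd_degree_Cons)
  qed (simp add: cd_degree_def)
  then have "cd_degree w = 0 \<longleftrightarrow> w = Word []" for w
    by (cases w) simp
  then show ?thesis by auto
qed

lemma cd_words_1: "{w. cd_degree w = Suc 0} = {Word [LC]}"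
proof -
  have "cd_degree w = Suc 0 \<longleftrightarrow> w = Word [LC]" for w
  proof (cases "letters w")
    case Nil
    then show ?thesis by (cases w) (auto simp: cd_degree_def)
  next
    case (Cons x xs)
    then have w: "w = Word (x # xs)" by (cases w) simp
    have "cd_degree (Word xs) = 0 \<longleftrightarrow> xs = []"
      using cd_words_0 by auto
    then show ?thesis by (cases x) (simp_all add: w cd_degree_Cons)
  qed
  then show ?thesis by auto
qed

lemma finite_cd_words: "finite {w. cd_degree w = m}"
  by (induction m rule: induct_nat_012) (simp_all add: cd_words_0 cd_words_1 cd_words_step)

text \<open>The claimed answer expressed in a and b, where it can be compared with the
  ab-index.\<close>

definition cd_sum :: "nat \<Rightarrow> ab_letter nc_poly" where
  "cd_sum m = cd_subst (\<Sum>w | cd_degree w = m. monomial_of w)"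

lemma cd_sum_alt: "cd_sum m = (\<Sum>w | cd_degree w = m. prod_list (map cd_letter_value (letters w)))"
  by (simp add: cd_sum_def cd_subst_sum monomial_of_def cd_subst_single)

lemma cd_sum_0: "cd_sum 0 = 1"
  by (simp add: cd_sum_alt cd_words_0)

lemma cd_sum_1: "cd_sum (Suc 0) = a_var + b_var"
  by (simp add: cd_sum_alt cd_words_1)

lemma cd_sum_step:
  "cd_sum (Suc (Suc m)) =
     (a_var + b_var) * cd_sum (Suc m) + (a_var * b_var + b_var * a_var) * cd_sum m"
proof -
  have inj: "inj_on (\<lambda>w. Word (x # letters w)) S" for x :: cd_letter and S
    by (auto simp: inj_on_def intro: free_word.expand)
  show ?thesis
    unfolding cd_sum_alt cd_words_step
    by (subst sum.union_disjoint) (auto simp: finite_cd_words sum.reindex inj sum_distrib_left)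
qed

section \<open>The matrix\<close>

lemma vector_4:
  "(vector [p, q, r, s] :: 'a::zero ^ 4) $ 1 = p"
  "(vector [p, q, r, s] :: 'a::zero ^ 4) $ 2 = q"
  "(vector [p, q, r, s] :: 'a::zero ^ 4) $ 3 = r"
  "(vector [p, q, r, s] :: 'a::zero ^ 4) $ 4 = s"
  unfolding vector_def by simp_all

lemma exists_4: "(\<exists>i::4. P i) \<longleftrightarrow> P 1 \<or> P 2 \<or> P 3 \<or> P 4"
  by (metis exhaust_4)

lemma M4_pos_iff:
  "M\<^sub>4 $ u $ v > 0 \<longleftrightarrow> (u, v) \<notin> {(1, 4), (2, 2), (3, 1), (3, 3), (4, 2)}"
  using exhaust_4[of u] exhaust_4[of v] by (elim disjE) (simp_all add: M\<^sub>4_def vector_4)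

text \<open>Row 3 of the matrix is supported on columns 2 and 4, column 2 on rows 1 and 3, so no
  index lies between 3 and 2. Every other pair has an intermediate index.\<close>

lemma matpow_M4_2_pos_iff: "matpow M\<^sub>4 2 $ u $ v > 0 \<longleftrightarrow> (u, v) \<noteq> (3, 2)"
proof -
  have "matpow M\<^sub>4 2 $ u $ v > 0 \<longleftrightarrow> (\<exists>w. M\<^sub>4 $ u $ w > 0 \<and> M\<^sub>4 $ w $ v > 0)"
    using matpow_add_pos_iff[of M\<^sub>4 1 1 u v] unfolding matpow_1 one_add_one .
  then show ?thesis
    using exhaust_4[of u] exhaust_4[of v] unfolding M4_pos_iff exists_4
    by (elim disjE) simp_all
qed

text \<open>Every row of the matrix has a positive entry outside column 3, and the square is
  positive outside row 3; this settles the cube. Positivity persists because no column is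
  zero.\<close>

lemma matpow_M4_pos:
  assumes "k \<ge> 3"
  shows "matpow M\<^sub>4 k $ u $ v > 0"
  using assms
proof (induction k arbitrary: v rule: dec_induct)
  case base
  have "\<exists>w. M\<^sub>4 $ u $ w > 0 \<and> matpow M\<^sub>4 2 $ w $ v > 0"
    unfolding M4_pos_iff matpow_M4_2_pos_iff exists_4
    using exhaust_4[of u] by (elim disjE) simp_all
  then have "matpow M\<^sub>4 (1 + 2) $ u $ v > 0" unfolding matpow_add_pos_iff matpow_1 .
  then show ?case by (simp only: one_plus_numeral add_One_commute one_add_one semiring_norm)
next
  case (step n)
  have "\<exists>w. M\<^sub>4 $ w $ v > 0"
    unfolding M4_pos_iff exists_4 using exhaust_4[of v] by (elim disjE) simp_all
  then have "\<exists>w. matpow M\<^sub>4 n $ u $ w > 0 \<and> matpow M\<^sub>4 1 $ w $ v > 0"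
    unfolding matpow_1 using step.IH by blast
  then have "matpow M\<^sub>4 (n + 1) $ u $ v > 0" unfolding matpow_add_pos_iff .
  then show ?case unfolding Suc_eq_plus1 .
qed

text \<open>The zero pattern of the powers with positive exponent, in a form the simplifier can
  evaluate. At exponent 0 it is true everywhere and does not describe the identity matrix.\<close>

definition M4_rel :: "nat \<Rightarrow> 4 \<Rightarrow> 4 \<Rightarrow> bool" where
  "M4_rel k u v \<longleftrightarrow>
     (k = 1 \<longrightarrow> (u, v) \<notin> {(1, 4), (2, 2), (3, 1), (3, 3), (4, 2)}) \<and> (k = 2 \<longrightarrow> (u, v) \<noteq> (3, 2))"

lemma matpow_M4_pos_iff:
  assumes "k > 0"
  shows "matpow M\<^sub>4 k $ u $ v > 0 \<longleftrightarrow> M4_rel k u v"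
proof -
  consider "k = 1" | "k = 2" | "k \<ge> 3" using assms by linarith
  then show ?thesis
  proof cases
    case 1
    then show ?thesis unfolding 1 M4_rel_def matpow_1 M4_pos_iff by simp
  next
    case 2
    then show ?thesis unfolding 2 M4_rel_def matpow_M4_2_pos_iff by simp
  next
    case 3
    then show ?thesis by (simp add: M4_rel_def matpow_M4_pos)
  qed
qed

section \<open>The Eulerian condition, level by level\<close>

lemma card_filter_4:
  "of_nat (card {w::4. P w}) =
     (of_bool (P 1) + of_bool (P 2) + of_bool (P 3) + of_bool (P 4) :: 'a::comm_semiring_1)"
proof -
  have "of_nat (card {w. P w}) = (\<Sum>w\<in>UNIV. of_bool (P w) :: 'a)"
    by (simp add: sum_of_bool_eq)
  then show ?thesis by (simp only: sum_4)
qed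

lemma sum_minus_one_powers:
  "k \<ge> 1 \<Longrightarrow> (\<Sum>l=1..<k. (-1) ^ l) = (- (1 + (-1) ^ k) / 2 :: rat)"
  by (induction k rule: dec_induct) (simp_all add: field_simps)

text \<open>Only the two levels next to each end can be incomplete; from rank 5 on these do not overlap.\<close>

lemma card_middle_level_M4:
  assumes "k \<ge> 5" "1 \<le> l" "l < k"
  shows "of_nat (card {w. M4_rel l u w \<and> M4_rel (k - l) w v}) =
    (4 - of_bool (l = 1) * (1 + of_bool (u = 3)) - of_bool (l = 2) * of_bool (u = 3)
       - of_bool (l = k - 1) * (1 + of_bool (v = 2)) - of_bool (l = k - 2) * of_bool (v = 2) :: rat)"
proof -
  have [simp]: "k - l = 1 \<longleftrightarrow> l = k - 1" "k - l = 2 \<longleftrightarrow> l = k - 2"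
    using assms by auto
  show ?thesis
    using exhaust_4[of u] exhaust_4[of v] assms
    unfolding M4_rel_def card_filter_4
    by (elim disjE) auto
qed

lemma sum_delta_mult:
  fixes f :: "'a \<Rightarrow> 'b::semiring_1"
  assumes "finite S" "i \<in> S"
  shows "(\<Sum>l\<in>S. of_bool (l = i) * f l) = f i"
proof -
  have "(\<Sum>l\<in>S. of_bool (l = i) * f l) = (\<Sum>l\<in>S. if l = i then f l else 0)"
    by (intro sum.cong) auto
  with assms show ?thesis by simp
qed

lemma level_eulerian_M4: "level_eulerian M\<^sub>4"
proof (rule level_eulerianI)
  fix u v k assume k: "k \<ge> 1" and "matpow M\<^sub>4 k $ u $ v > 0"
  then have uv: "M4_rel k u v" by (simp add: matpow_M4_pos_iff)
  have "1 + (-1) ^ k + (\<Sum>l=1..<k. (-1) ^ l *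
      of_nat (card {w. M4_rel l u w \<and> M4_rel (k - l) w v})) = (0 :: rat)"
  proof (cases "k \<ge> 5")
    case True
    have "(\<Sum>l=1..<k. (-1) ^ l * of_nat (card {w. M4_rel l u w \<and> M4_rel (k - l) w v})) =
      (\<Sum>l=1..<k. 4 * (-1) ^ l - of_bool (l = 1) * ((-1) ^ l * (1 + of_bool (u = 3)))
         - of_bool (l = 2) * ((-1) ^ l * of_bool (u = 3))
         - of_bool (l = k - 1) * ((-1) ^ l * (1 + of_bool (v = 2)))
         - of_bool (l = k - 2) * ((-1) ^ l * of_bool (v = 2)) :: rat)"
      using True by (intro sum.cong refl) (simp add: card_middle_level_M4 algebra_simps)
    also have "\<dots> = 4 * (\<Sum>l=1..<k. (-1) ^ l) + (1 + of_bool (u = 3)) - of_bool (u = 3)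
        - (-1) ^ (k - 1) * (1 + of_bool (v = 2)) - (-1) ^ (k - 2) * of_bool (v = 2)"
      using True
      by (simp add: sum_subtractf sum_distrib_left sum_delta_mult
          del: sum_mult_of_bool_eq sum_of_bool_mult_eq)
    \<comment> \<open>The extra deficits for \<open>u = 3\<close> sit on adjacent levels and cancel,
      as do those for \<open>v = 2\<close>. Net corrections 1 and \<open>(-1) ^ k\<close> remain,
      against the main term \<open>- 2 * (1 + (-1) ^ k)\<close>.\<close>
    also have "\<dots> = - 1 - (-1) ^ k"
      using True by (simp only: sum_minus_one_powers[OF k]) (simp add: power_diff field_simps)
    finally show ?thesis by simp
  next
    case False
    \<comment> \<open>In these ranks the incomplete levels of the two ends can coincide, so all
      pairs \<open>u\<close>, \<open>v\<close> are checked.\<close>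
    with k consider "k = 1" | "k = 2" | "k = 3" | "k = 4" by linarith
    then show ?thesis
      using uv exhaust_4[of u] exhaust_4[of v]
      by cases
        (elim disjE;
          simp add: card_filter_4 M4_rel_def sum.atLeastLessThan_Suc numeral_eq_Suc)+
  qed
  then show "1 + (-1) ^ k + (\<Sum>l=1..<k. (-1) ^ l *
      of_nat (card {w. matpow M\<^sub>4 l $ u $ w > 0 \<and> matpow M\<^sub>4 (k - l) $ w $ v > 0})) = (0 :: rat)"
    by (simp add: matpow_M4_pos_iff)
qed

section \<open>The renewal recursion for the ab-index\<close>

lemma renewal_identity:
  fixes a b :: "'a::ring_1" and X :: "nat \<Rightarrow> 'a"
  assumes X0: "X 0 = 0" and X1: "X (Suc 0) = 1"
    and step: "\<And>n. X (Suc (Suc n)) = (a + b) * X (Suc n) + (a * b + b * a) * X n"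
  shows "(a - b) ^ n + (\<Sum>l=1..<Suc n. (a - b) ^ (l - 1) * b *
      (X (Suc n - l) + X (Suc n - l) + X (Suc n - l) + (a + b) * X (Suc n - l - 1))) =
    X (Suc n) + b * X n"
proof -
  \<comment> \<open>The total over the four rows with \<open>j\<close> ranks to go:
    \<open>X j\<close> for rows 1, 2 and 4, and \<open>(a + b) * X (j - 1)\<close> for row
    3.\<close>
  define S where "S = (\<lambda>j. X j + X j + X j + (a + b) * X (j - 1))"
  have "(a - b) ^ n + (\<Sum>i<n. (a - b) ^ i * b * S (n - i)) = X (Suc n) + b * X n"
  proof (induction n)
    case 0
    show ?case by (simp add: X0 X1)
  next
    case (Suc n)
    have "(a - b) ^ Suc n + (\<Sum>i<Suc n. (a - b) ^ i * b * S (Suc n - i)) =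
        (a - b) * ((a - b) ^ n + (\<Sum>i<n. (a - b) ^ i * b * S (n - i))) + b * S (Suc n)"
      unfolding sum.lessThan_Suc_shift
      by (simp add: distrib_left sum_distrib_left mult.assoc)
    \<comment> \<open>The coefficient of \<open>X n\<close> is
      \<open>(a - b) * b + b * (a + b) = a * b + b * a\<close>, and that of \<open>X (Suc n)\<close>
      is \<open>(a - b) + 3 * b = (a + b) + b\<close>.\<close>
    also have "\<dots> = X (Suc (Suc n)) + b * X (Suc n)"
      unfolding Suc.IH by (simp add: step S_def algebra_simps)
    finally show ?case .
  qed
  then show ?thesis
    by (simp add: S_def sum.shift_bounds_Suc_ivl lessThan_atLeast0 del: sum.op_ivl_Suc)
qed

text \<open>Indexed by rank, which exceeds the degree by one. The value 0 at rank 0 makes the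
  recursion hold from \<open>n = 0\<close> on.\<close>

definition cd_sum_rank :: "nat \<Rightarrow> ab_letter nc_poly" where
  "cd_sum_rank n = (if n = 0 then 0 else cd_sum (n - 1))"

lemma cd_sum_rank_0: "cd_sum_rank 0 = 0"
  by (simp add: cd_sum_rank_def)

lemma cd_sum_rank_1: "cd_sum_rank (Suc 0) = 1"
  by (simp add: cd_sum_rank_def cd_sum_0)

lemma cd_sum_rank_step:
  "cd_sum_rank (Suc (Suc n)) =
     (a_var + b_var) * cd_sum_rank (Suc n) + (a_var * b_var + b_var * a_var) * cd_sum_rank n"
  by (cases n) (simp_all add: cd_sum_rank_def cd_sum_0 cd_sum_1 cd_sum_step)

text \<open>The closed form to be proved for the ab-index of a rank \<open>n\<close> interval from
  row \<open>u\<close> to row 1.\<close>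

definition M4_index :: "4 \<Rightarrow> nat \<Rightarrow> ab_letter nc_poly" where
  "M4_index u n = (if u = 3 then (a_var + b_var) * cd_sum_rank (n - 1) else cd_sum_rank n)"

lemma sum_filter_4:
  fixes f :: "4 \<Rightarrow> 'a::ring_1"
  shows "(\<Sum>w | P w. f w) =
    of_bool (P 1) * f 1 + of_bool (P 2) * f 2 + of_bool (P 3) * f 3 + of_bool (P 4) * f 4"
proof -
  have "(\<Sum>w | P w. f w) = (\<Sum>w\<in>UNIV. of_bool (P w) * f w)"
    by (intro sum.mono_neutral_cong_left) auto
  then show ?thesis by (simp only: sum_4)
qed

text \<open>There is no relation from row 3 to column 1 in rank 1, but \<^term>\<open>M4_index 3 1\<close> vanishes, so
  the condition \<^term>\<open>M4_rel j w 1\<close> does not affect the sum.\<close>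

lemma sum_M4_index:
  assumes "l \<ge> 1" "j \<ge> 1"
  shows "(\<Sum>w | M4_rel l u w \<and> M4_rel j w 1. M4_index w j) =
    cd_sum_rank j + cd_sum_rank j + cd_sum_rank j + (a_var + b_var) * cd_sum_rank (j - 1)
    - of_bool (l = 1) *
        (cd_sum_rank j + of_bool (u = 3) * ((a_var + b_var) * cd_sum_rank (j - 1)))
    - of_bool (l = 2) * (of_bool (u = 3) * cd_sum_rank j)"
proof -
  have "M4_index w j = 0" if "\<not> M4_rel j w 1" for w
    using that assms by (auto simp: M4_rel_def M4_index_def cd_sum_rank_0)
  then have "(\<Sum>w | M4_rel l u w \<and> M4_rel j w 1. M4_index w j) = (\<Sum>w | M4_rel l u w. M4_index w j)"
    by (intro sum.mono_neutral_left) auto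
  then show ?thesis
    using exhaust_4[of u] assms
    unfolding sum_filter_4 M4_rel_def M4_index_def
    by (elim disjE) auto
qed

text \<open>The induction on rank ranges over all \<open>u\<close> and \<open>i\<close>, since
  cutting off the first step moves the lower endpoint; the top stays fixed.\<close>

lemma ab_between_M4:
  assumes "k > 0" "M4_rel k u 1"
  shows "ab_between (level_poset M\<^sub>4) snd (u, i) (1, i + int k) = M4_index u k"
  using assms
proof (induction k arbitrary: u i rule: less_induct)
  case (less k)
  define e :: "ab_letter nc_poly" where "e = a_var - b_var"
  define c :: "ab_letter nc_poly" where "c = a_var + b_var"
  define X where "X = cd_sum_rank"
  obtain n where k: "k = Suc n" using less.prems by (cases k) auto
  have IH: "ab_between (level_poset M\<^sub>4) snd (w, i + int l) (1, i + int k) = M4_index w (k - l)"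
    if "l \<in> {1..<k}" "M4_rel (k - l) w 1" for l w
    using less.IH[of "k - l" w "i + int l"] that by simp
  have "ab_between (level_poset M\<^sub>4) snd (u, i) (1, i + int k) = e ^ (k - 1) +
    (\<Sum>l=1..<k. \<Sum>w | M4_rel l u w \<and> M4_rel (k - l) w 1. e ^ (l - 1) * b_var * M4_index w (k - l))"
    using less.prems
    by (subst ab_between_level_poset_step)
      (auto simp: matpow_M4_pos_iff IH e_def intro!: sum.cong)
  also have "\<dots> = e ^ (k - 1) + (\<Sum>l=1..<k. e ^ (l - 1) * b_var *
      (X (k - l) + X (k - l) + X (k - l) + c * X (k - l - 1))
      - of_bool (l = 1) *
          (e ^ (l - 1) * b_var * (X (k - l) + of_bool (u = 3) * (c * X (k - l - 1))))
      - of_bool (l = 2) * (e ^ (l - 1) * b_var * (of_bool (u = 3) * X (k - l))))"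
    unfolding sum_distrib_left[symmetric]
    by (intro arg_cong2[of _ _ _ _ "(+)"] sum.cong refl)
      (auto simp: sum_M4_index X_def c_def algebra_simps eval_nat_numeral)
  \<comment> \<open>Complete levels would give \<open>X k + b_var * X n\<close>; the subtracted sums
    account for the elements missing on levels 1 and 2.\<close>
  also have "\<dots> = X k + b_var * X n
      - (\<Sum>l=1..<k. of_bool (l = 1) *
          (e ^ (l - 1) * b_var * (X (k - l) + of_bool (u = 3) * (c * X (k - l - 1)))))
      - (\<Sum>l=1..<k. of_bool (l = 2) * (e ^ (l - 1) * b_var * (of_bool (u = 3) * X (k - l))))"
    using renewal_identity[OF cd_sum_rank_0 cd_sum_rank_1 cd_sum_rank_step, of n]
    unfolding sum_subtractf X_def e_def c_def k by (simp add: algebra_simps del: sum.op_ivl_Suc)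
  also have "\<dots> = M4_index u k"
  proof (cases n)
    case 0
    with less.prems have "u \<noteq> 3" by (auto simp: k M4_rel_def)
    with 0 show ?thesis by (simp add: k X_def M4_index_def cd_sum_rank_0)
  next
    case (Suc m)
    have first: "(\<Sum>l=1..<k. of_bool (l = 1) *
        (e ^ (l - 1) * b_var * (X (k - l) + of_bool (u = 3) * (c * X (k - l - 1))))) =
        b_var * (X n + of_bool (u = 3) * (c * X m))"
      by (subst sum_delta_mult) (auto simp: k Suc)
    have second: "(\<Sum>l=1..<k. of_bool (l = 2) *
        (e ^ (l - 1) * b_var * (of_bool (u = 3) * X (k - l)))) =
        e * b_var * (of_bool (u = 3) * X m)"
    proof (cases m)
      \<comment> \<open>Here \<open>k = 2\<close>, so level 2 is not an inner level; the right side
        vanishes too, because \<open>X 0 = 0\<close>.\<close>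
      case 0
      then show ?thesis by (simp add: k Suc X_def cd_sum_rank_0)
    next
      case (Suc m')
      with \<open>n = Suc m\<close> show ?thesis by (subst sum_delta_mult) (auto simp: k)
    qed
    \<comment> \<open>The term \<open>b_var * X n\<close> cancels. For \<open>u = 3\<close> a
      further \<open>(b_var * c + e * b_var) * X m\<close> is removed; its coefficient is the value
      of d, so \<open>c * X n\<close> is left.\<close>
    show ?thesis
      unfolding first second
      by (simp add: M4_index_def k Suc X_def c_def e_def cd_sum_rank_step algebra_simps)
  qed
  finally show ?case .
qed

theorem corollary8p3:
  shows "level_eulerian M\<^sub>4 \<and>
    (\<forall>m::nat. cd_index (interval_poset (level_poset M\<^sub>4) (1, 0) (1, int m + 1)) snd =
       (\<Sum>w | cd_degree w = m. monomial_of w))"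
proof (intro conjI allI)
  show "level_eulerian M\<^sub>4" by (rule level_eulerian_M4)
next
  fix m :: nat
  let ?I = "interval_poset (level_poset M\<^sub>4) (1, 0) (1, int m + 1)"
  have rel: "M4_rel (Suc m) 1 1" by (simp add: M4_rel_def)
  then have "((1, 0), (1, 0 + int (Suc m))) \<in> level_poset M\<^sub>4"
    unfolding level_poset_add_iff by (simp only: matpow_M4_pos_iff)
  then have lp: "((1, 0), (1, int m + 1)) \<in> level_poset M\<^sub>4" by (simp add: add.commute)
  \<comment> \<open>The top level is written \<open>0 + int (Suc m)\<close> to match the form
    \<open>i + int k\<close> of the induction.\<close>
  have "ab_index ?I snd = ab_between (level_poset M\<^sub>4) snd (1, 0) (1, 0 + int (Suc m))"
    unfolding ab_index_def ab_between_def
      full_chains_interval_poset[OF refl_level_poset antisym_level_poset lp]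
    by (simp add: add.commute)
  also have "\<dots> = M4_index 1 (Suc m)"
    using rel by (intro ab_between_M4) simp
  also have "\<dots> = cd_sum m"
    by (simp add: M4_index_def cd_sum_rank_def)
  finally show "cd_index ?I snd = (\<Sum>w | cd_degree w = m. monomial_of w)"
    by (intro cd_index_eqI) (simp add: cd_sum_def)
qed

end
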